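(* For all integers $n \geq 5$ and $k \geq 1$ with $n \geq 2k$, there exists a Latin square $L=[L_{ij}]$ of order $n$ (rows, columns and symbols indexed by $\{0,\dots,n-1\}$) such that $L_{ii}=i$ for all $i \in \{0,\ldots,n-k-1\}$ and the $k\times k$ submatrix formed by the rows and columns indexed by $\{n-k,\ldots,n-1\}$ is a Latin square on the symbols $\{0,\ldots,k-1\}$. Consequently, $L$ has a maximal partial transversal of size $n-k$.
   Context: A Latin square of order $n$ is an $n\times n$ array on $n$ symbols in which each symbol occurs once in each row and each column; its entries are the triples $(i,j,L_{ij})$. A line is the set of all entries in a given row, in a given column, or with a given symbol. A partial transversal is a set of entries in which every line is represented at most once; it is maximal if it is not contained in any larger partial transversal. *)

theory Defs
  imports Main
begin

text \<open>
  An array is a function \<open>L\<close> of a row index and a column index, restricted to a row set \<open>R\<close>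
  and a column set \<open>C\<close>; values outside \<open>R \<times> C\<close> are irrelevant. Keeping \<open>R\<close>, \<open>C\<close> and the
  symbol set \<open>S\<close> explicit lets the same notion apply to submatrices.
\<close>

definition latin_square_on ::
    "nat \<Rightarrow> 'r set \<Rightarrow> 'c set \<Rightarrow> 's set \<Rightarrow> ('r \<Rightarrow> 'c \<Rightarrow> 's) \<Rightarrow> bool" where
  "latin_square_on n R C S L \<longleftrightarrow>
     finite R \<and> card R = n \<and> finite C \<and> card C = n \<and> finite S \<and> card S = n \<and>
     (\<forall>i\<in>R. \<forall>j\<in>C. L i j \<in> S) \<and>
     (\<forall>i\<in>R. \<forall>s\<in>S. \<exists>!j. j \<in> C \<and> L i j = s) \<and>
     (\<forall>j\<in>C. \<forall>s\<in>S. \<exists>!i. i \<in> R \<and> L i j = s)"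

abbreviation latin_square :: "nat \<Rightarrow> (nat \<Rightarrow> nat \<Rightarrow> nat) \<Rightarrow> bool" where
  "latin_square n L \<equiv> latin_square_on n {..<n} {..<n} {..<n} L"

definition entries :: "nat \<Rightarrow> (nat \<Rightarrow> nat \<Rightarrow> nat) \<Rightarrow> (nat \<times> nat \<times> nat) set" where
  "entries n L = {(i, j, L i j) | i j. i < n \<and> j < n}"

definition lines :: "nat \<Rightarrow> (nat \<Rightarrow> nat \<Rightarrow> nat) \<Rightarrow> (nat \<times> nat \<times> nat) set set" where
  "lines n L =
     {{(i, j, s) \<in> entries n L. i = r} | r. r < n} \<union>
     {{(i, j, s) \<in> entries n L. j = c} | c. c < n} \<union>
     {{(i, j, s) \<in> entries n L. s = t} | t. t < n}"

definition partial_transversal ::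
    "nat \<Rightarrow> (nat \<Rightarrow> nat \<Rightarrow> nat) \<Rightarrow> (nat \<times> nat \<times> nat) set \<Rightarrow> bool" where
  "partial_transversal n L T \<longleftrightarrow>
     T \<subseteq> entries n L \<and> (\<forall>l\<in>lines n L. card (T \<inter> l) \<le> 1)"

definition maximal_partial_transversal ::
    "nat \<Rightarrow> (nat \<Rightarrow> nat \<Rightarrow> nat) \<Rightarrow> (nat \<times> nat \<times> nat) set \<Rightarrow> bool" where
  "maximal_partial_transversal n L T \<longleftrightarrow>
     partial_transversal n L T \<and> \<not> (\<exists>T'. partial_transversal n L T' \<and> T \<subset> T')"

end

theory Submission
  imports Defs
begin

text \<open>
  Put \<open>m = n - k \<ge> k\<close> and cut \<open>L\<close> into the \<open>m \<times> m\<close> block \<open>A\<close>, the strips \<open>B\<close> and \<open>C\<close> to its right and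
  below it, and a corner filled by a cyclic square on \<open>{..<k}\<close>. The idea is a prolongation that leaves
  the diagonal alone: start from an idempotent Latin square of order \<open>m\<close>, keep its cells with
  symbols below \<open>k\<close>, overwrite \<open>k\<close> cells of each other symbol by the new symbols, and move the
  overwritten symbols into the strips.

  For odd \<open>m\<close> the square is \<open>(i + j)/2\<close> over \<open>\<int>/m\<close>, and the cells overwritten by the \<open>e\<close>-th new symbol
  lie on the broken diagonal \<open>j - i = 2(e + 1)\<close>. For even \<open>m\<close> one first prolongs the odd square of order
  \<open>q = m - 1\<close> along the diagonal \<open>j - i = -2\<close> by a point \<open>\<infinity>\<close>, and the same overwriting works for
  \<open>k \<le> m - 3\<close>. For \<open>k \<ge> m - 2\<close> at most two symbols are overwritten; then the strips are read off from
  the conjugates of the idempotent square, for \<open>k = m - 2\<close> using that the cells of \<open>\<infinity>\<close> and \<open>0\<close> fall into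
  \<open>2 \<times> 2\<close> subsquares.

  The diagonal of \<open>A\<close> is a maximal partial transversal, since it meets all symbols below \<open>m\<close>, hence
  all symbols of the corner.
\<close>

section \<open>Block decomposition\<close>

lemma latin_square_onI:
  assumes fin: "finite R" "finite C" "finite S" and card: "card R = n" "card C = n" "card S = n"
    and range: "\<And>i j. i \<in> R \<Longrightarrow> j \<in> C \<Longrightarrow> L i j \<in> S"
    and row: "\<And>i. i \<in> R \<Longrightarrow> inj_on (L i) C"
    and col: "\<And>j. j \<in> C \<Longrightarrow> inj_on (\<lambda>i. L i j) R"
  shows "latin_square_on n R C S L"
proof -
  have ex1: "\<exists>!x. x \<in> X \<and> f x = s"
    if "inj_on f X" "f ` X \<subseteq> S" "card X = n" "s \<in> S" for f :: "'x \<Rightarrow> 'c" and X s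
  proof -
    have "f ` X = S"
      using that fin card by (metis card_image card_subset_eq)
    with that(1,4) show ?thesis
      by (metis imageE inj_onD)
  qed
  have "\<exists>!j. j \<in> C \<and> L i j = s" if "i \<in> R" "s \<in> S" for i s
    using that range by (intro ex1 row) (auto simp: card)
  moreover have "\<exists>!i. i \<in> R \<and> L i j = s" if "j \<in> C" "s \<in> S" for j s
    using that range by (intro ex1[of "\<lambda>i. L i j"] col) (auto simp: card)
  ultimately show ?thesis
    using fin card range by (auto simp: latin_square_on_def)
qed

definition diagonal_square :: "nat \<Rightarrow> nat \<Rightarrow> (nat \<Rightarrow> nat \<Rightarrow> nat) \<Rightarrow> bool" where
  "diagonal_square m k L \<longleftrightarrow>
     latin_square (m + k) L \<and> (\<forall>i<m. L i i = i) \<and>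
     latin_square_on k {m..<m + k} {m..<m + k} {..<k} L"

lemma maximal_diagonal:
  assumes "diagonal_square m k L" "k \<le> m"
  shows "maximal_partial_transversal (m + k) L ((\<lambda>i. (i, i, i)) ` {..<m})"
    (is "maximal_partial_transversal ?n L ?T")
proof -
  have diag: "L i i = i" if "i < m" for i
    using assms that by (simp add: diagonal_square_def)
  have range: "L i j < m + k" if "i < m + k" "j < m + k" for i j
    using assms that by (auto simp: diagonal_square_def latin_square_on_def)
  have corner: "L i j < k" if "m \<le> i" "m \<le> j" "i < m + k" "j < m + k" for i j
    using assms that by (auto simp: diagonal_square_def latin_square_on_def)
  have "finite (entries ?n L)"
    by (rule finite_subset[where B = "{..<?n} \<times> {..<?n} \<times> {..<?n}"])
      (auto simp: entries_def range)
  then have share: False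
    if "partial_transversal ?n L U" "l \<in> lines ?n L" "x \<in> U \<inter> l" "y \<in> U \<inter> l" "x \<noteq> y" for U l x y
  proof -
    have "card {x, y} \<le> card (U \<inter> l)"
      using that \<open>finite (entries ?n L)\<close>
      by (intro card_mono) (auto simp: partial_transversal_def intro: finite_subset)
    with that show False
      by (auto simp: partial_transversal_def)
  qed
  have sub: "?T \<subseteq> entries ?n L"
    by (auto simp: entries_def diag)
  have one: "card (?T \<inter> l) \<le> 1" if "l \<in> lines ?n L" for l
  proof -
    have "\<exists>r. ?T \<inter> l \<subseteq> {(r, r, r)}"
      using that by (auto simp: lines_def)
    then obtain r where "?T \<inter> l \<subseteq> {(r, r, r)}" ..
    then show ?thesis
      using card_mono[of "{(r, r, r)}" "?T \<inter> l"] by simp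
  qed
  have "\<not> partial_transversal ?n L U" if "?T \<subset> U" for U
  proof
    assume U: "partial_transversal ?n L U"
    obtain i j where x: "(i, j, L i j) \<in> U" "(i, j, L i j) \<notin> ?T" "i < ?n" "j < ?n"
      using U \<open>?T \<subset> U\<close> by (force simp: partial_transversal_def entries_def)
    define d where "d = (if i < m then i else if j < m then j else L i j)"
    have d: "d < m" "i = d \<or> j = d \<or> L i j = d"
      using corner[of i j] x assms(2) by (auto simp: d_def)
    have e: "(d, d, d) \<in> entries ?n L" "(i, j, L i j) \<in> entries ?n L" "(d, d, d) \<in> U"
      using d(1) x(3,4) sub \<open>?T \<subset> U\<close> by (auto simp: entries_def)
    have lines: "{(a, b, c) \<in> entries ?n L. a = d} \<in> lines ?n L"
        "{(a, b, c) \<in> entries ?n L. b = d} \<in> lines ?n L"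
        "{(a, b, c) \<in> entries ?n L. c = d} \<in> lines ?n L"
      using d(1) by (auto simp: lines_def intro!: exI[of _ d])
    have ne: "(i, j, L i j) \<noteq> (d, d, d)"
      using d x by auto
    show False
      using d(2) share[OF U lines(1) _ _ ne] share[OF U lines(2) _ _ ne]
        share[OF U lines(3) _ _ ne] x e by auto
  qed
  moreover have "partial_transversal ?n L ?T"
    using sub one by (simp add: partial_transversal_def)
  ultimately show ?thesis
    unfolding maximal_partial_transversal_def by blast
qed

lemma bij_betw_prescribed_subset:
  assumes "finite I" "K \<subseteq> I" "card I = m" "card K = k"
  obtains f where "bij_betw f I {..<m}" "f ` K = {..<k}"
proof -
  have "k \<le> m"
    using assms card_mono by auto
  obtain f where f: "bij_betw f K {..<k}"
    using assms finite_subset by (metis ex_bij_betw_finite_nat lessThan_atLeast0)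
  obtain g where g: "bij_betw g (I - K) {k..<m}"
    using assms finite_subset by (metis bij_betw_iff_card card_Diff_subset card_atLeastLessThan
        finite_Diff finite_atLeastLessThan)
  have "bij_betw (\<lambda>x. if x \<in> K then f x else g x) K {..<k}"
    using f by (simp cong: bij_betw_cong)
  moreover have "bij_betw (\<lambda>x. if x \<in> K then f x else g x) (I - K) {k..<m}"
    using g by (subst bij_betw_cong[where g = g]) auto
  ultimately have "bij_betw (\<lambda>x. if x \<in> K then f x else g x) (K \<union> (I - K)) ({..<k} \<union> {k..<m})"
    by (rule bij_betw_combine) auto
  moreover have "K \<union> (I - K) = I" "{..<k} \<union> {k..<m} = {..<m}"
    using assms \<open>k \<le> m\<close> by auto
  moreover have "(\<lambda>x. if x \<in> K then f x else g x) ` K = {..<k}"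
    using f by (simp add: bij_betw_def)
  ultimately show ?thesis
    using that by simp
qed

text \<open>
  \<open>A\<close>, \<open>B\<close> and \<open>C\<close> are the top left, top right and bottom left blocks. Their symbols are \<open>Inl i\<close> for
  \<open>i \<in> I\<close> and the new ones \<open>Inr e\<close>, where \<open>e \<in> E\<close> also indexes the last rows and columns.
\<close>

lemma diagonal_square_from_blocks:
  fixes A :: "'a \<Rightarrow> 'a \<Rightarrow> 'a + 'b" and B :: "'a \<Rightarrow> 'b \<Rightarrow> 'a + 'b" and C :: "'b \<Rightarrow> 'a \<Rightarrow> 'a + 'b"
  assumes I: "finite I" "card I = m" and K: "K \<subseteq> I" "card K = k" and E: "finite E" "card E = k"
    and A: "\<And>i j. i \<in> I \<Longrightarrow> j \<in> I \<Longrightarrow> A i j \<in> I <+> E"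
    and B: "\<And>i e. i \<in> I \<Longrightarrow> e \<in> E \<Longrightarrow> B i e \<in> (I - K) <+> E"
    and C: "\<And>e j. e \<in> E \<Longrightarrow> j \<in> I \<Longrightarrow> C e j \<in> (I - K) <+> E"
    and diag: "\<And>i. i \<in> I \<Longrightarrow> A i i = Inl i"
    and A_row: "\<And>i. i \<in> I \<Longrightarrow> inj_on (A i) I"
    and A_col: "\<And>j. j \<in> I \<Longrightarrow> inj_on (\<lambda>i. A i j) I"
    and B_row: "\<And>i. i \<in> I \<Longrightarrow> inj_on (B i) E"
    and B_col: "\<And>e. e \<in> E \<Longrightarrow> inj_on (\<lambda>i. B i e) I"
    and C_row: "\<And>e. e \<in> E \<Longrightarrow> inj_on (C e) I"
    and C_col: "\<And>j. j \<in> I \<Longrightarrow> inj_on (\<lambda>e. C e j) E"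
    and AB: "\<And>i j e. i \<in> I \<Longrightarrow> j \<in> I \<Longrightarrow> e \<in> E \<Longrightarrow> A i j \<noteq> B i e"
    and AC: "\<And>i j e. i \<in> I \<Longrightarrow> j \<in> I \<Longrightarrow> e \<in> E \<Longrightarrow> A i j \<noteq> C e j"
  shows "\<exists>L. diagonal_square m k L"
proof -
  obtain f where f: "bij_betw f I {..<m}" "f ` K = {..<k}"
    using bij_betw_prescribed_subset[OF I(1) K(1) I(2) K(2)] .
  obtain r where r: "bij_betw r E {..<k}"
    using E by (metis ex_bij_betw_finite_nat lessThan_atLeast0)
  define enc where "enc = case_sum f (\<lambda>e. m + r e)"
  have f_lt: "f i < m" if "i \<in> I" for i
    using f(1) that by (auto simp: bij_betw_def)
  have r_lt: "r e < k" if "e \<in> E" for e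
    using r that by (auto simp: bij_betw_def)
  have f_eq: "f i = f j \<longleftrightarrow> i = j" if "i \<in> I" "j \<in> I" for i j
    using f(1) that by (auto simp: bij_betw_def inj_on_def)
  have r_eq: "r i = r j \<longleftrightarrow> i = j" if "i \<in> E" "j \<in> E" for i j
    using r that by (auto simp: bij_betw_def inj_on_def)
  have f_small: "f i < k \<longleftrightarrow> i \<in> K" if "i \<in> I" for i
    using f K(1) that f_eq by (metis imageE imageI lessThan_iff subsetD)
  have enc_inj: "inj_on enc (I <+> E)"
    using f_lt r_lt by (force simp: inj_on_def enc_def f_eq r_eq)
  have enc_lt: "enc x < m + k" if "x \<in> I <+> E" for x
    using that f_lt r_lt by (auto simp: enc_def trans_less_add1)
  define a where "a = the_inv_into I f"
  define b where "b = (\<lambda>x. the_inv_into E r (x - m))"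
  have a: "a x \<in> I" "f (a x) = x" if "x < m" for x
    using f(1) that
    by (auto simp: a_def bij_betw_def f_the_inv_into_f intro: the_inv_into_into)
  have b: "b x \<in> E" "m + r (b x) = x" if "m \<le> x" "x < m + k" for x
  proof -
    have "x - m \<in> r ` E" "inj_on r E"
      using r that by (auto simp: bij_betw_def)
    then have "b x \<in> E" "r (b x) = x - m"
      by (auto simp: b_def f_the_inv_into_f intro: the_inv_into_into)
    with that show "b x \<in> E" "m + r (b x) = x"
      by auto
  qed
  have a_eq: "a x = a y \<longleftrightarrow> x = y" if "x < m" "y < m" for x y
    using a that by metis
  have b_eq: "b x = b y \<longleftrightarrow> x = y" if "m \<le> x" "x < m + k" "m \<le> y" "y < m + k" for x y
    using b that by metis
  define L where "L = (\<lambda>x y. if x < m then if y < m then enc (A (a x) (a y))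
     else enc (B (a x) (b y)) else if y < m then enc (C (b x) (a y)) else (x + y) mod k)"
  have mk: "k \<le> m"
    using K I card_mono by auto
  have B': "B i e \<in> I <+> E" and B_big: "k \<le> enc (B i e)" if "i \<in> I" "e \<in> E" for i e
    using B[OF that] f_small mk by (force simp: enc_def not_less[symmetric])+
  have C': "C e i \<in> I <+> E" and C_big: "k \<le> enc (C e i)" if "i \<in> I" "e \<in> E" for i e
    using C[OF that(2,1)] f_small mk by (force simp: enc_def not_less[symmetric])+
  have enc_eq: "enc x = enc y \<longleftrightarrow> x = y" if "x \<in> I <+> E" "y \<in> I <+> E" for x y
    using enc_inj that by (auto simp: inj_on_def)
  have big_row: "enc (B (a x) (b y)) \<noteq> z mod k" if "x < m" "m \<le> y" "y < m + k" for x y z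
    using B_big[OF a(1)[OF that(1)] b(1)[OF that(2,3)]] that
    by (metis linorder_not_le mod_less_divisor add_0_right bot_nat_0.not_eq_extremum)
  have big_col: "enc (C (b y) (a x)) \<noteq> z mod k" if "x < m" "m \<le> y" "y < m + k" for x y z
    using C_big[OF a(1)[OF that(1)] b(1)[OF that(2,3)]] that
    by (metis linorder_not_le mod_less_divisor add_0_right bot_nat_0.not_eq_extremum)
  have cyclic: "y = z" if "(x + y) mod k = (x + z) mod k" "m \<le> y" "y < m + k" "m \<le> z" "z < m + k"
    for x y z
  proof -
    have "\<bar>int y - int z\<bar> < int k"
      using that by auto
    moreover have "int k dvd int y - int z"
      using that(1) by (metis add_diff_cancel_left mod_eq_dvd_iff of_nat_add of_nat_mod)
    ultimately show ?thesis
      by (metis dvd_imp_le_int linorder_not_le eq_iff_diff_eq_0 of_nat_eq_iff abs_of_nat)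
  qed
  have L_row: "inj_on (L x) {..<m + k}" if "x < m + k" for x
  proof (rule inj_onI)
    fix y z assume yz: "y \<in> {..<m + k}" "z \<in> {..<m + k}" "L x y = L x z"
    show "y = z"
    proof (cases "x < m")
      case True
      note x = True a(1)[OF True]
      show ?thesis
        using yz x A_row[OF x(2)] B_row[OF x(2)] AB[OF x(2)] AB[OF x(2), symmetric]
        by (auto simp: L_def enc_eq A B' a b a_eq b_eq dest: inj_onD split: if_splits)
    next
      case False
      then have x: "m \<le> x" "b x \<in> E"
        using b that by auto
      show ?thesis
        using yz x that C_row[OF x(2)] big_col[of _ x] big_col[of _ x, symmetric]
        by (auto simp: L_def enc_eq C' a b a_eq b_eq dest: inj_onD cyclic split: if_splits)
    qed
  qed
  have L_col: "inj_on (\<lambda>x. L x y) {..<m + k}" if "y < m + k" for y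
  proof (rule inj_onI)
    fix x z assume xz: "x \<in> {..<m + k}" "z \<in> {..<m + k}" "L x y = L z y"
    show "x = z"
    proof (cases "y < m")
      case True
      note y = True a(1)[OF True]
      show ?thesis
        using xz y A_col[OF y(2)] C_col[OF y(2)] AC[OF _ y(2)] AC[OF _ y(2), symmetric]
        by (auto simp: L_def enc_eq A C' a b a_eq b_eq dest: inj_onD split: if_splits)
    next
      case False
      then have y: "m \<le> y" "b y \<in> E"
        using b that by auto
      show ?thesis
        using xz y that B_col[OF y(2)] big_row[of _ y] big_row[of _ y, symmetric] cyclic[of y x z]
        by (auto simp: L_def enc_eq B' a b a_eq b_eq add.commute[of _ y] dest: inj_onD
            split: if_splits)
    qed
  qed
  have L_lt: "L x y < m + k" if "x < m + k" "y < m + k" for x y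
    using that A B' C' a b enc_lt by (auto simp: L_def not_less intro: order.strict_trans2[of _ k])
  have "latin_square (m + k) L"
    by (rule latin_square_onI) (use L_row L_col L_lt in auto)
  moreover have "\<forall>i<m. L i i = i"
    by (auto simp: L_def diag a enc_def)
  moreover have "latin_square_on k {m..<m + k} {m..<m + k} {..<k} L"
  proof (rule latin_square_onI)
    show "inj_on (L x) {m..<m + k}" if "x \<in> {m..<m + k}" for x
      using that by (intro inj_on_subset[OF L_row]) auto
    show "inj_on (\<lambda>x. L x y) {m..<m + k}" if "y \<in> {m..<m + k}" for y
      using that by (intro inj_on_subset[OF L_col]) auto
  qed (auto simp: L_def)
  ultimately show ?thesis
    unfolding diagonal_square_def by blast
qed

section \<open>Rearranging few symbols of an idempotent square\<close>

lemma latin_square_on_row_unique: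
  assumes "latin_square_on n R C S L" "i \<in> R" "j \<in> C" "j' \<in> C" "L i j = L i j'"
  shows "j = j'"
proof -
  have "\<exists>!k. k \<in> C \<and> L i k = L i j"
    using assms(1-3) by (simp add: latin_square_on_def)
  then show ?thesis
    using assms(3-5) by (auto elim!: ex1E)
qed

lemma latin_square_on_col_unique:
  assumes "latin_square_on n R C S L" "i \<in> R" "i' \<in> R" "j \<in> C" "L i j = L i' j"
  shows "i = i'"
proof -
  have "\<exists>!k. k \<in> R \<and> L k j = L i j"
    using assms(1,2,4) by (simp add: latin_square_on_def)
  then show ?thesis
    using assms(2,3,5) by (auto elim!: ex1E)
qed

text \<open>
  Here \<open>I - W\<close> is the set of small symbols and also indexes the new symbols, rows and columns. The entry
  of \<open>B\<close> in row \<open>i\<close> and new column \<open>x\<close> is the label, under the inverse of \<open>c\<close>, of the column in which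
  \<open>x\<close> stands in row \<open>i\<close> of \<open>M\<close>; the entries of \<open>C\<close> are the corresponding rows. The labels left over go
  to the cells of \<open>A\<close> with a symbol in \<open>W\<close>, arranged by \<open>g\<close>.
\<close>

lemma diagonal_square_of_idempotent:
  fixes M :: "'a \<Rightarrow> 'a \<Rightarrow> 'a"
  assumes M: "latin_square_on m I I I M" and idem: "\<And>i. i \<in> I \<Longrightarrow> M i i = i" and W: "W \<subseteq> I"
    and c: "c ` I \<subseteq> I" "inj_on c I"
    and g: "\<And>i j. i \<in> I \<Longrightarrow> j \<in> I \<Longrightarrow> M i j \<in> W \<Longrightarrow> g i j \<in> I"
    and g_row: "\<And>i j. i \<in> I \<Longrightarrow> j \<in> I \<Longrightarrow> M i j \<in> W \<Longrightarrow> M i (c (g i j)) \<in> W"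
    and g_col: "\<And>i j. i \<in> I \<Longrightarrow> j \<in> I \<Longrightarrow> M i j \<in> W \<Longrightarrow> M (g i j) j \<in> W"
    and g_diag: "\<And>w. w \<in> W \<Longrightarrow> g w w = w"
    and inj_row: "\<And>i. i \<in> I \<Longrightarrow> inj_on (g i) {j \<in> I. M i j \<in> W}"
    and inj_col: "\<And>j. j \<in> I \<Longrightarrow> inj_on (\<lambda>i. g i j) {i \<in> I. M i j \<in> W}"
  shows "\<exists>L. diagonal_square m (m - card W) L"
proof -
  have I: "finite I" "card I = m" and M_in: "\<And>i j. i \<in> I \<Longrightarrow> j \<in> I \<Longrightarrow> M i j \<in> I"
    and ex_col: "\<And>i x. i \<in> I \<Longrightarrow> x \<in> I \<Longrightarrow> \<exists>!j. j \<in> I \<and> M i j = x"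
    and ex_row: "\<And>j x. j \<in> I \<Longrightarrow> x \<in> I \<Longrightarrow> \<exists>!i. i \<in> I \<and> M i j = x"
    using M by (auto simp: latin_square_on_def)
  note M_row = latin_square_on_row_unique[OF M] and M_col = latin_square_on_col_unique[OF M]
  define R where "R i x = (THE j. j \<in> I \<and> M i j = x)" for i x
  define Q where "Q x j = (THE i. i \<in> I \<and> M i j = x)" for x j
  have R: "R i x \<in> I" "M i (R i x) = x" if "i \<in> I" "x \<in> I" for i x
    using theI'[OF ex_col[OF that]] by (simp_all add: R_def)
  have Q: "Q x j \<in> I" "M (Q x j) j = x" if "j \<in> I" "x \<in> I" for j x
    using theI'[OF ex_row[OF that]] by (simp_all add: Q_def)
  define c' where "c' = the_inv_into I c"
  have "c ` I = I"
    using c I by (simp add: endo_inj_surj)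
  then have c': "c' j \<in> I" "c (c' j) = j" if "j \<in> I" for j
    using c that by (auto simp: c'_def f_the_inv_into_f intro: the_inv_into_into)
  define \<psi> :: "'a \<Rightarrow> 'a + 'a" where "\<psi> x = (if x \<in> W then Inl x else Inr x)" for x
  have psi_eq: "\<psi> x = \<psi> y \<longleftrightarrow> x = y" for x y
    by (auto simp: \<psi>_def)
  have psi_in: "\<psi> x \<in> (I - (I - W)) <+> (I - W)" if "x \<in> I" for x
    using that by (auto simp: \<psi>_def)
  have psi_Inl: "\<psi> x = Inl y \<Longrightarrow> y \<in> W" "Inl y = \<psi> x \<Longrightarrow> y \<in> W" for x y
    by (auto simp: \<psi>_def split: if_splits)
  define A where "A i j = (if M i j \<in> W then \<psi> (g i j) else Inl (M i j))" for i j
  define B where "B i x = \<psi> (c' (R i x))" for i x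
  define C where "C x j = \<psi> (Q x j)" for x j
  have "card (I - W) = m - card W"
    using W I by (simp add: card_Diff_subset finite_subset)
  then show ?thesis
  proof (intro diagonal_square_from_blocks[of I m "I - W" _ "I - W" A B C])
    show "A i j \<in> I <+> (I - W)" if "i \<in> I" "j \<in> I" for i j
      using psi_in[OF g[OF that]] M_in that by (auto simp: A_def)
    show "A i i = Inl i" if "i \<in> I" for i
      using that by (simp add: A_def idem g_diag \<psi>_def)
    show "inj_on (A i) I" if "i \<in> I" for i
    proof (rule inj_onI)
      fix j j' assume j: "j \<in> I" "j' \<in> I" "A i j = A i j'"
      show "j = j'"
      proof (cases "M i j \<in> W")
        case True
        with j have "M i j' \<in> W" "g i j = g i j'"
          by (auto simp: A_def psi_eq dest: psi_Inl split: if_splits)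
        with True j inj_row[OF that] show ?thesis
          by (auto dest: inj_onD)
      next
        case False
        with j have "M i j = M i j'"
          by (auto simp: A_def dest: psi_Inl split: if_splits)
        with j that show ?thesis
          using M_row by blast
      qed
    qed
    show "inj_on (\<lambda>i. A i j) I" if "j \<in> I" for j
    proof (rule inj_onI)
      fix i i' assume i: "i \<in> I" "i' \<in> I" "A i j = A i' j"
      show "i = i'"
      proof (cases "M i j \<in> W")
        case True
        with i have "M i' j \<in> W" "g i j = g i' j"
          by (auto simp: A_def psi_eq dest: psi_Inl split: if_splits)
        with True i inj_col[OF that] show ?thesis
          by (auto dest: inj_onD)
      next
        case False
        with i have "M i j = M i' j"
          by (auto simp: A_def dest: psi_Inl split: if_splits)
        with i that show ?thesis
          using M_col by blast
      qed
    qed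
    show "inj_on (B i) (I - W)" if "i \<in> I" for i
      by (rule inj_onI) (metis B_def psi_eq c'(2) R DiffD1 that)
    show "inj_on (\<lambda>i. B i x) I" if "x \<in> I - W" for x
      by (rule inj_onI) (metis B_def psi_eq c'(2) R DiffD1 that M_col)
    show "inj_on (C x) I" if "x \<in> I - W" for x
      by (rule inj_onI) (metis C_def psi_eq Q DiffD1 that M_row)
    show "inj_on (\<lambda>x. C x j) (I - W)" if "j \<in> I" for j
      by (rule inj_onI) (metis C_def psi_eq Q DiffD1 that)
    show "A i j \<noteq> B i x" if ij: "i \<in> I" "j \<in> I" and x: "x \<in> I - W" for i j x
    proof
      assume eq: "A i j = B i x"
      then have W: "M i j \<in> W" and "g i j = c' (R i x)"
        by (auto simp: A_def B_def psi_eq dest: psi_Inl split: if_splits)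
      then have "M i (c (g i j)) = x"
        using R[of i x] c' ij x by auto
      with g_row[OF ij W] x show False
        by auto
    qed
    show "A i j \<noteq> C x j" if ij: "i \<in> I" "j \<in> I" and x: "x \<in> I - W" for i j x
    proof
      assume eq: "A i j = C x j"
      then have W: "M i j \<in> W" and "g i j = Q x j"
        by (auto simp: A_def C_def psi_eq dest: psi_Inl split: if_splits)
      then have "M (g i j) j = x"
        using Q[of j x] ij x by auto
      with g_col[OF ij W] x show False
        by auto
    qed
  qed (use I psi_in c' R Q in \<open>auto simp: B_def C_def\<close>)
qed

lemma diagonal_square_of_idempotent_1:
  assumes M: "latin_square_on m I I I M" and idem: "\<And>i. i \<in> I \<Longrightarrow> M i i = i" and w: "w \<in> I"
  shows "\<exists>L. diagonal_square m (m - 1) L"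
proof -
  have ex_col: "\<And>i x. i \<in> I \<Longrightarrow> x \<in> I \<Longrightarrow> \<exists>!j. j \<in> I \<and> M i j = x"
    using M by (auto simp: latin_square_on_def)
  note M_row = latin_square_on_row_unique[OF M] and M_col = latin_square_on_col_unique[OF M]
  define c where "c i = (THE j. j \<in> I \<and> M i j = w)" for i
  have c: "c i \<in> I" "M i (c i) = w" if "i \<in> I" for i
    using theI'[OF ex_col[OF that w]] by (simp_all add: c_def)
  have "\<exists>L. diagonal_square m (m - card {w}) L"
  proof (rule diagonal_square_of_idempotent[OF M idem, where g = "\<lambda>i j. i" and c = c])
    show "c ` I \<subseteq> I"
      using c by blast
    show "inj_on c I"
      by (rule inj_onI) (metis c M_col)
    show "inj_on (\<lambda>j. i) {j \<in> I. M i j \<in> {w}}" if "i \<in> I" for i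
      by (rule inj_onI, rule M_row[OF that]) auto
  qed (use c w in \<open>auto simp: inj_on_def\<close>)
  then show ?thesis
    by simp
qed

text \<open>
  Swapping rows \<open>i\<close> and \<open>\<tau> i\<close> swaps the symbols \<open>u\<close> and \<open>v\<close>, so the cells of these two symbols split
  into \<open>2 \<times> 2\<close> subsquares, each of which is given its own pair of symbols.
\<close>

lemma diagonal_square_of_intercalates:
  fixes M :: "'a \<Rightarrow> 'a \<Rightarrow> 'a"
  assumes M: "latin_square_on m I I I M" and idem: "\<And>i. i \<in> I \<Longrightarrow> M i i = i"
    and uv: "u \<in> I" "v \<in> I" "pos u" "\<not> pos v"
    and tau: "\<And>i. i \<in> I \<Longrightarrow> \<tau> i \<in> I" "\<And>i. i \<in> I \<Longrightarrow> \<tau> (\<tau> i) = i"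
      "\<And>i. i \<in> I \<Longrightarrow> pos (\<tau> i) \<longleftrightarrow> \<not> pos i"
    and swap: "\<And>i j. i \<in> I \<Longrightarrow> j \<in> I \<Longrightarrow> M i j = u \<Longrightarrow> M (\<tau> i) j = v"
      "\<And>i j. i \<in> I \<Longrightarrow> j \<in> I \<Longrightarrow> M i j = v \<Longrightarrow> M (\<tau> i) j = u"
  shows "\<exists>L. diagonal_square m (m - 2) L"
proof -
  have ex_col: "\<And>i x. i \<in> I \<Longrightarrow> x \<in> I \<Longrightarrow> \<exists>!j. j \<in> I \<and> M i j = x"
    using M by (auto simp: latin_square_on_def)
  note M_row = latin_square_on_row_unique[OF M] and M_col = latin_square_on_col_unique[OF M]
  have uv_ne: "u \<noteq> v"
    using uv by auto
  define c where "c i = (THE j. j \<in> I \<and> M i j = u)" for i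
  have c: "c i \<in> I" "M i (c i) = u" if "i \<in> I" for i
    using theI'[OF ex_col[OF that uv(1)]] by (simp_all add: c_def)
  define g where "g i j = (if pos i \<longleftrightarrow> M i j = u then i else \<tau> i)" for i j
  have tau_ne: "\<tau> i \<noteq> i" if "i \<in> I" for i
    using tau(3)[OF that] by metis
  have "\<exists>L. diagonal_square m (m - card {u, v}) L"
  proof (rule diagonal_square_of_idempotent[of m I M _ c g])
    show "c ` I \<subseteq> I"
      using c by auto
    show "inj_on c I"
      by (rule inj_onI) (metis c M_col)
    show "g i j \<in> I" if "i \<in> I" for i j
      using that tau by (auto simp: g_def)
    show "M i (c (g i j)) \<in> {u, v}" if "i \<in> I" for i j
      using c swap(1)[of "\<tau> i" "c (\<tau> i)"] that tau(1,2) by (auto simp: g_def)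
    show "M (g i j) j \<in> {u, v}" if "i \<in> I" "j \<in> I" "M i j \<in> {u, v}" for i j
      using that swap by (auto simp: g_def)
    show "g w w = w" if "w \<in> {u, v}" for w
      using that uv uv_ne idem by (auto simp: g_def)
    show "inj_on (g i) {j \<in> I. M i j \<in> {u, v}}" if i: "i \<in> I" for i
    proof (rule inj_onI)
      fix j j' assume j: "j \<in> {j \<in> I. M i j \<in> {u, v}}" "j' \<in> {j \<in> I. M i j \<in> {u, v}}"
        "g i j = g i j'"
      then have "M i j = M i j'"
        using tau_ne[OF i] uv_ne by (auto simp: g_def split: if_splits)
      with j i show "j = j'"
        using M_row[of i j j'] by auto
    qed
    show "inj_on (\<lambda>i. g i j) {i \<in> I. M i j \<in> {u, v}}" if j: "j \<in> I" for j
    proof (rule inj_onI, rule ccontr)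
      fix i i' assume i: "i \<in> {i \<in> I. M i j \<in> {u, v}}" "i' \<in> {i \<in> I. M i j \<in> {u, v}}"
        "g i j = g i' j" "i \<noteq> i'"
      then have iI: "i \<in> I" "i' \<in> I"
        by auto
      have ne: "M i j \<noteq> M i' j"
        using i j M_col[of i i' j] by auto
      then have "M (\<tau> i) j = M i' j"
        using i iI j swap by auto
      then have i': "i' = \<tau> i"
        using iI j tau(1) M_col[of "\<tau> i" i' j] by auto
      have "(M i' j = u) \<longleftrightarrow> M i j \<noteq> u"
        using i ne uv_ne by auto
      then have "g i' j = (if pos i \<longleftrightarrow> M i j = u then i' else \<tau> i')"
        using iI tau(3) by (auto simp: g_def i')
      then show False
        using i(3,4) iI tau(2) by (auto simp: g_def i' split: if_splits)
    qed
  qed (use M idem uv in auto)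
  then show ?thesis
    using uv_ne by (simp add: numeral_2_eq_2)
qed

section \<open>Squares over an odd modulus\<close>

lemma residue_unique:
  fixes q x y :: int
  assumes "q dvd x - y" "0 \<le> x" "x < q" "0 \<le> y" "y < q"
  shows "x = y"
  using assms by (metis mod_eq_dvd_iff mod_pos_pos_trivial)

definition half :: "int \<Rightarrow> int \<Rightarrow> int" where
  "half q x = ((q + 1) div 2 * x) mod q"

lemma half_bounds: "q > 0 \<Longrightarrow> 0 \<le> half q x" "q > 0 \<Longrightarrow> half q x < q"
  by (simp_all add: half_def)

lemma dvd_half:
  assumes "odd q"
  shows "q dvd 2 * half q x - x"
proof -
  obtain h where h: "q = 2 * h + 1"
    using assms by (rule oddE)
  have "half q x = (h + 1) * x - q * ((h + 1) * x div q)"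
    by (simp add: half_def h minus_mult_div_eq_mod add.commute)
  then have "2 * half q x - x = q * (x - 2 * ((h + 1) * x div q))"
    by (simp add: h algebra_simps)
  then show ?thesis
    by simp
qed

locale odd_modulus =
  fixes q :: int
  assumes q: "q > 0" "odd q"
begin

abbreviation mid :: "int \<Rightarrow> int \<Rightarrow> int" where "mid i j \<equiv> half q (i + j)"
abbreviation dif :: "int \<Rightarrow> int \<Rightarrow> int" where "dif i j \<equiv> half q (j - i)"

lemmas bounds = half_bounds[OF q(1)]

lemma dvd_double: "q dvd 2 * x \<Longrightarrow> q dvd x"
  using q by (simp add: coprime_dvd_mult_right_iff)

lemma dvd_row: "q dvd mid i j - dif i j - i"
proof (rule dvd_double)
  show "q dvd 2 * (mid i j - dif i j - i)"
    using dvd_diff[OF dvd_half[OF q(2), of "i + j"] dvd_half[OF q(2), of "j - i"]]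
    by (simp add: algebra_simps)
qed

lemma dvd_col: "q dvd mid i j + dif i j - j"
proof (rule dvd_double)
  show "q dvd 2 * (mid i j + dif i j - j)"
    using dvd_add[OF dvd_half[OF q(2), of "i + j"] dvd_half[OF q(2), of "j - i"]]
    by (simp add: algebra_simps)
qed

lemma mid_row: "mid i j = (i + dif i j) mod q"
  using dvd_row[of i j] bounds[of "i + j"]
  by (metis diff_diff_eq2 diff_diff_add add.commute mod_eq_dvd_iff mod_pos_pos_trivial)

lemma mid_col: "mid i j = (j - dif i j) mod q"
proof -
  have "q dvd mid i j - (j - dif i j)"
    using dvd_col[of i j] by (simp add: algebra_simps)
  then show ?thesis
    using bounds[of "i + j"] by (metis mod_eq_dvd_iff mod_pos_pos_trivial)
qed

lemma dif_row: "dif i j = (mid i j - i) mod q"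
proof -
  have "q dvd dif i j - (mid i j - i)"
    using dvd_row[of i j] by (subst dvd_minus_iff[symmetric]) (simp add: algebra_simps)
  then show ?thesis
    using bounds[of "j - i"] by (metis mod_eq_dvd_iff mod_pos_pos_trivial)
qed

lemma dif_col: "dif i j = (j - mid i j) mod q"
proof -
  have "q dvd dif i j - (j - mid i j)"
    using dvd_col[of i j] by (simp add: algebra_simps)
  then show ?thesis
    using bounds[of "j - i"] by (metis mod_eq_dvd_iff mod_pos_pos_trivial)
qed

lemma col_unique:
  assumes "mid i j = mid i j' \<or> dif i j = dif i j'" "0 \<le> j" "j < q" "0 \<le> j'" "j' < q"
  shows "j = j'"
proof -
  have "mid i j = mid i j'" "dif i j = dif i j'"
    using assms(1) by (metis mid_row dif_row)+
  then have "q dvd j - j'"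
    using dvd_diff[OF dvd_col[of i j'] dvd_col[of i j]] by (simp add: algebra_simps)
  then show ?thesis
    using assms residue_unique by blast
qed

lemma row_unique:
  assumes "mid i j = mid i' j \<or> dif i j = dif i' j" "0 \<le> i" "i < q" "0 \<le> i'" "i' < q"
  shows "i = i'"
proof -
  have "mid i j = mid i' j" "dif i j = dif i' j"
    using assms(1) by (metis mid_col dif_col)+
  then have "q dvd i - i'"
    using dvd_diff[OF dvd_row[of i' j] dvd_row[of i j]] by (simp add: algebra_simps)
  then show ?thesis
    using assms residue_unique by blast
qed

lemma dif_same [simp]: "dif i i = 0"
  by (simp add: half_def)

lemma mid_same: "0 \<le> i \<Longrightarrow> i < q \<Longrightarrow> mid i i = i"
  by (simp only: mid_row[of i i] dif_same) simp

lemma shift_unique: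
  assumes "(x + e) mod q = (x + e') mod q" "\<bar>e - e'\<bar> < q"
  shows "e = e'"
proof -
  have "q dvd e - e'"
    using assms(1) by (metis add_diff_cancel_left mod_eq_dvd_iff)
  then show ?thesis
    using assms(2) by (metis abs_dvd_iff dvd_imp_le_int dvd_abs_iff eq_iff_diff_eq_0
          linorder_not_le q(1) abs_of_pos)
qed

lemma shift_unique':
  assumes "(x - e) mod q = (x - e') mod q" "\<bar>e - e'\<bar> < q"
  shows "e = e'"
  using shift_unique[of x "- e" "- e'"] assms by simp

lemma line_iff:
  assumes "0 \<le> i" "i < q" "0 \<le> i'" "i' < q"
  shows "(i + e) mod q = (i' + e) mod q \<longleftrightarrow> i = i'" "(i - e) mod q = (i' - e) mod q \<longleftrightarrow> i = i'"
  using shift_unique[of e i i'] shift_unique[of "- e" i i'] assms by (auto simp: add.commute)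

lemma col_iff:
  assumes "0 \<le> j" "j < q" "0 \<le> j'" "j' < q"
  shows "mid i j = mid i j' \<longleftrightarrow> j = j'" "dif i j = dif i j' \<longleftrightarrow> j = j'"
  using col_unique assms by blast+

lemma row_iff:
  assumes "0 \<le> i" "i < q" "0 \<le> i'" "i' < q"
  shows "mid i j = mid i' j \<longleftrightarrow> i = i'" "dif i j = dif i' j \<longleftrightarrow> i = i'"
  using row_unique assms by blast+

text \<open>
  In row \<open>i\<close> of \<open>B\<close> the places of the symbols \<open>s = i + e + 1 < k\<close> are free. The reflection
  \<open>e \<mapsto> k - 1 - s\<close> permutes the set of these \<open>e\<close>, which are also the new symbols missing from row \<open>i\<close> of
  \<open>A\<close>; in \<open>C\<close> the reflection is \<open>e \<mapsto> s\<close> with \<open>s = j - e - 1\<close>.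
\<close>

lemma diagonal_square_odd:
  assumes k: "0 \<le> k" "k \<le> q"
  shows "\<exists>L. diagonal_square (nat q) (nat k) L"
proof -
  define A :: "int \<Rightarrow> int \<Rightarrow> int + int" where
    "A i j = (if k \<le> mid i j \<and> 1 \<le> dif i j \<and> dif i j \<le> k then Inr (dif i j - 1)
       else Inl (mid i j))" for i j
  define B :: "int \<Rightarrow> int \<Rightarrow> int + int" where
    "B i e = (let s = (i + (e + 1)) mod q in if k \<le> s then Inl s else Inr (k - 1 - s))" for i e
  define C :: "int \<Rightarrow> int \<Rightarrow> int + int" where
    "C e j = (let s = (j - (e + 1)) mod q in if k \<le> s then Inl s else Inr s)" for e j
  have col_e: "e = e'" if "(i + (e + 1)) mod q = (i + (e' + 1)) mod q" "e \<in> {0..<k}" "e' \<in> {0..<k}"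
    for i e e'
    using shift_unique[OF that(1)] that k by auto
  have row_e: "e = e'" if "(j - (e + 1)) mod q = (j - (e' + 1)) mod q" "e \<in> {0..<k}" "e' \<in> {0..<k}"
    for j e e'
    using shift_unique'[OF that(1)] that k by auto
  show ?thesis
  proof (rule diagonal_square_from_blocks[of "{0..<q}" _ "{0..<k}" _ "{0..<k}" A B C])
    show "A i j \<in> {0..<q} <+> {0..<k}" for i j
      using bounds[of "i + j"] by (auto simp: A_def)
    show "B i e \<in> ({0..<q} - {0..<k}) <+> {0..<k}" for i e
      using pos_mod_bound[OF q(1)] pos_mod_sign[OF q(1), of "i + (e + 1)"]
      by (auto simp: B_def Let_def)
    show "C e j \<in> ({0..<q} - {0..<k}) <+> {0..<k}" for e j
      using pos_mod_bound[OF q(1)] pos_mod_sign[OF q(1), of "j - (e + 1)"]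
      by (auto simp: C_def Let_def)
    show "A i i = Inl i" if "i \<in> {0..<q}" for i
      using mid_same[of i] dif_same[of i] that by (simp add: A_def)
    show "inj_on (A i) {0..<q}" for i
      by (rule inj_onI) (auto simp: col_iff A_def split: if_splits)
    show "inj_on (\<lambda>i. A i j) {0..<q}" for j
      by (rule inj_onI) (auto simp: row_iff A_def split: if_splits)
    show "inj_on (B i) {0..<k}" for i
      by (rule inj_onI, rule col_e[of i]) (auto simp: B_def Let_def split: if_splits)
    show "inj_on (\<lambda>i. B i e) {0..<q}" for e
      by (rule inj_onI) (auto simp: line_iff B_def Let_def split: if_splits)
    show "inj_on (C e) {0..<q}" for e
      by (rule inj_onI) (auto simp: line_iff C_def Let_def split: if_splits)
    show "inj_on (\<lambda>e. C e j) {0..<k}" for j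
      by (rule inj_onI, rule row_e[of j]) (auto simp: C_def Let_def split: if_splits)
    show "A i j \<noteq> B i e" if e: "e \<in> {0..<k}" for i j e
    proof
      assume eq: "A i j = B i e"
      define s where "s = (i + (e + 1)) mod q"
      have s: "0 \<le> s" "s < q"
        using q by (auto simp: s_def)
      show False
      proof (cases "k \<le> s")
        case True
        then have "mid i j = s" and not: "\<not> (1 \<le> dif i j \<and> dif i j \<le> k)"
          using eq by (auto simp: A_def B_def Let_def s_def[symmetric] split: if_splits)
        then have "dif i j = (e + 1) mod q"
          by (subst dif_row) (simp add: s_def mod_simps)
        also have "\<dots> = e + 1"
          using True s e k by simp
        finally show False
          using not e by simp
      next
        case False
        then have "dif i j = k - s" "k \<le> mid i j"
          using eq by (auto simp: A_def B_def Let_def s_def[symmetric] split: if_splits)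
        then have "mid i j = (i + (k - s)) mod q"
          by (simp add: mid_row[of i j])
        also have "\<dots> = (k - 1 - e) mod q"
          unfolding mod_eq_dvd_iff using mod_eq_dvd_iff[of "i + (e + 1)" q s]
          by (simp add: s_def algebra_simps)
        also have "\<dots> = k - 1 - e"
          using e k by simp
        finally show False
          using e \<open>k \<le> mid i j\<close> by simp
      qed
    qed
    show "A i j \<noteq> C e j" if e: "e \<in> {0..<k}" for i j e
    proof
      assume eq: "A i j = C e j"
      define s where "s = (j - (e + 1)) mod q"
      have s: "0 \<le> s" "s < q"
        using q by (auto simp: s_def)
      show False
      proof (cases "k \<le> s")
        case True
        then have "mid i j = s" and not: "\<not> (1 \<le> dif i j \<and> dif i j \<le> k)"
          using eq by (auto simp: A_def C_def Let_def s_def[symmetric] split: if_splits)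
        then have "dif i j = (e + 1) mod q"
          by (subst dif_col) (simp add: s_def mod_simps)
        also have "\<dots> = e + 1"
          using True s e k by simp
        finally show False
          using not e by simp
      next
        case False
        then have "dif i j = s + 1" "k \<le> mid i j"
          using eq by (auto simp: A_def C_def Let_def s_def[symmetric] split: if_splits)
        then have "mid i j = (j - (s + 1)) mod q"
          by (simp add: mid_col[of i j])
        also have "\<dots> = e mod q"
          unfolding mod_eq_dvd_iff using mod_eq_dvd_iff[of "j - (e + 1)" q s]
          by (simp add: s_def algebra_simps)
        also have "\<dots> = e"
          using e k by simp
        finally show False
          using e \<open>k \<le> mid i j\<close> by simp
      qed
    qed
  qed (use k in auto)
qed

lemma mid_pred_iff: "mid i j = (i - 1) mod q \<longleftrightarrow> dif i j = q - 1"
proof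
  assume "mid i j = (i - 1) mod q"
  then have "dif i j = (- 1) mod q"
    by (subst dif_row) (simp add: mod_simps)
  then show "dif i j = q - 1"
    using q by (simp add: zmod_minus1)
next
  assume "dif i j = q - 1"
  then have "mid i j = (i + (q - 1)) mod q"
    using mid_row[of i j] by simp
  also have "\<dots> = (i - 1) mod q"
    unfolding mod_eq_dvd_iff by simp
  finally show "mid i j = (i - 1) mod q" .
qed

lemma mid_succ_iff: "mid i j = (j + 1) mod q \<longleftrightarrow> dif i j = q - 1"
proof
  assume "mid i j = (j + 1) mod q"
  then have "dif i j = (- 1) mod q"
    by (subst dif_col) (simp add: mod_simps)
  then show "dif i j = q - 1"
    using q by (simp add: zmod_minus1)
next
  assume "dif i j = q - 1"
  then have "mid i j = (j - (q - 1)) mod q"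
    using mid_col[of i j] by simp
  also have "\<dots> = (j + 1) mod q"
    unfolding mod_eq_dvd_iff by simp
  finally show "mid i j = (j + 1) mod q" .
qed

abbreviation points :: "int option set" where
  "points \<equiv> insert None (Some ` {0..<q})"

lemma card_points: "card points = nat q + 1"
  by (subst card_insert_disjoint) (auto simp: card_image)

text \<open>
  \<open>None\<close> is the point \<open>\<infinity>\<close>. It counts as a small symbol, so that only the \<open>k - 1\<close> residues below
  \<open>k - 1\<close> are small. The free places \<open>e\<close> of a row of \<open>B\<close>, those with \<open>s = i + e + 1 < k - 1\<close>, form up to
  two intervals, distinguished by the sign of \<open>s - e\<close>, and each of them is reflected separately.
\<close>

lemma diagonal_square_even:
  assumes k: "1 \<le> k" "k \<le> q - 2"
  shows "\<exists>L. diagonal_square (nat q + 1) (nat k) L"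
proof -
  define A :: "int option \<Rightarrow> int option \<Rightarrow> int option + int" where
    "A i j = (case (i, j) of
         (None, None) \<Rightarrow> Inl None
       | (None, Some j) \<Rightarrow> Inl (Some ((j + 1) mod q))
       | (Some i, None) \<Rightarrow> Inl (Some ((i - 1) mod q))
       | (Some i, Some j) \<Rightarrow>
           if dif i j = q - 1 then Inl None
           else if k - 1 \<le> mid i j \<and> 1 \<le> dif i j \<and> dif i j \<le> k then Inr (dif i j - 1)
           else Inl (Some (mid i j)))" for i j
  define B :: "int option \<Rightarrow> int \<Rightarrow> int option + int" where
    "B i e = (case i of
         None \<Rightarrow> Inr (k - 1 - e)
       | Some i \<Rightarrow> let s = (i + (e + 1)) mod q in
           if k - 1 \<le> s then Inl (Some s) else if e \<le> s then Inr (k - 2 - s) else Inr (k - 1 - s))"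
    for i e
  define C :: "int \<Rightarrow> int option \<Rightarrow> int option + int" where
    "C e j = (case j of
         None \<Rightarrow> Inr (k - 1 - e)
       | Some j \<Rightarrow> let s = (j - (e + 1)) mod q in
           if k - 1 \<le> s then Inl (Some s) else if s + e \<le> k - 2 then Inr s else Inr (s + 1))"
    for e j
  have A_simps:
    "A None None = Inl None" "A None (Some j) = Inl (Some ((j + 1) mod q))"
    "A (Some i) None = Inl (Some ((i - 1) mod q))"
    "A (Some i) (Some j) = (if dif i j = q - 1 then Inl None
       else if k - 1 \<le> mid i j \<and> 1 \<le> dif i j \<and> dif i j \<le> k then Inr (dif i j - 1)
       else Inl (Some (mid i j)))" for i j
    by (simp_all add: A_def)
  have B_simps:
    "B None e = Inr (k - 1 - e)"
    "B (Some i) e = (let s = (i + (e + 1)) mod q in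
       if k - 1 \<le> s then Inl (Some s) else if e \<le> s then Inr (k - 2 - s) else Inr (k - 1 - s))"
    for i e
    by (simp_all add: B_def)
  have C_simps:
    "C e None = Inr (k - 1 - e)"
    "C e (Some j) = (let s = (j - (e + 1)) mod q in
       if k - 1 \<le> s then Inl (Some s) else if s + e \<le> k - 2 then Inr s else Inr (s + 1))"
    for e j
    by (simp_all add: C_def)
  have residue: "0 \<le> x mod q" "x mod q < q" "- 1 < x mod q" for x
    using pos_mod_sign[OF q(1), of x] pos_mod_bound[OF q(1), of x] by linarith+
  have col_e: "e = e'" if "(i + (e + 1)) mod q = (i + (e' + 1)) mod q" "e \<in> {0..<k}" "e' \<in> {0..<k}"
    for i e e'
    using shift_unique[OF that(1)] that k by auto
  have row_e: "e = e'" if "(j - (e + 1)) mod q = (j - (e' + 1)) mod q" "e \<in> {0..<k}" "e' \<in> {0..<k}"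
    for j e e'
    using shift_unique'[OF that(1)] that k by auto
  have col_e_Suc: "e' = e + 1"
    if "(i + (e' + 1)) mod q = (i + (e + 1)) mod q + 1" "e \<in> {0..<k}" "e' \<in> {0..<k}" for i e e'
  proof -
    have "(i + (e' + 1)) mod q = ((i + (e + 1)) mod q + 1) mod q"
      using that(1) residue(1,2)[of "i + (e' + 1)"] by simp
    then have "(i + (e' + 1)) mod q = (i + (e + 2)) mod q"
      by (simp add: mod_simps algebra_simps)
    moreover have "\<bar>(e' + 1) - (e + 2)\<bar> < q"
      using that(2,3) k by auto
    ultimately have "e' + 1 = e + 2"
      by (rule shift_unique)
    then show ?thesis
      by simp
  qed
  have row_e_Suc: "e' = e + 1"
    if "(j - (e + 1)) mod q = (j - (e' + 1)) mod q + 1" "e \<in> {0..<k}" "e' \<in> {0..<k}" for j e e'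
  proof -
    have "(j - (e + 1)) mod q = ((j - (e' + 1)) mod q + 1) mod q"
      using that(1) residue(1,2)[of "j - (e + 1)"] by simp
    then have "(j - (e + 1)) mod q = (j - e') mod q"
      by (simp add: mod_simps algebra_simps)
    moreover have "\<bar>(e + 1) - e'\<bar> < q"
      using that(2,3) k by auto
    ultimately have "e + 1 = e'"
      by (rule shift_unique')
    then show ?thesis
      by simp
  qed
  show ?thesis
  proof (rule diagonal_square_from_blocks[of points _ "insert None (Some ` {0..<k - 1})" _ "{0..<k}"
        A B C])
    show "card (insert None (Some ` {0..<k - 1})) = nat k"
      using k by (subst card_insert_disjoint) (auto simp: card_image)
    show "A i j \<in> points <+> {0..<k}" if "i \<in> points" "j \<in> points" for i j
      using that bounds residue by (auto simp: A_simps)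
    show "B i e \<in> (points - insert None (Some ` {0..<k - 1})) <+> {0..<k}"
      if "i \<in> points" "e \<in> {0..<k}" for i e
      using that residue by (auto simp: B_simps Let_def)
    show "C e j \<in> (points - insert None (Some ` {0..<k - 1})) <+> {0..<k}"
      if "e \<in> {0..<k}" "j \<in> points" for e j
      using that residue by (auto simp: C_simps Let_def)
    show "A i i = Inl i" if "i \<in> points" for i
      using that mid_same dif_same k by (auto simp: A_simps)
    show "inj_on (A i) points" for i
    proof (cases i)
      case None
      then show ?thesis
        by (auto simp: line_iff inj_on_def A_simps)
    next
      case (Some i')
      then show ?thesis
        using mid_pred_iff[of i']
        by (auto simp: col_iff inj_on_def A_simps eq_commute[of "(i' - 1) mod q"]
            intro: col_unique[of i'] split: if_splits)
    qed
    show "inj_on (\<lambda>i. A i j) points" for j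
    proof (cases j)
      case None
      then show ?thesis
        by (auto simp: line_iff inj_on_def A_simps)
    next
      case (Some j')
      then show ?thesis
        using mid_succ_iff[of _ j']
        by (auto simp: row_iff inj_on_def A_simps eq_commute[of "(j' + 1) mod q"]
            intro: row_unique[of _ j'] split: if_splits)
    qed
    show "inj_on (B i) {0..<k}" for i
    proof (cases i)
      case None
      then show ?thesis
        by (auto simp: inj_on_def B_simps)
    next
      case (Some i')
      show ?thesis
      proof (rule inj_onI)
        fix e e' assume e: "e \<in> {0..<k}" "e' \<in> {0..<k}" "B i e = B i e'"
        have "(i' + (e + 1)) mod q = (i' + (e' + 1)) mod q \<or>
          (i' + (e + 1)) mod q = (i' + (e' + 1)) mod q + 1 \<and>
            (i' + (e + 1)) mod q < e \<and> e' \<le> (i' + (e' + 1)) mod q \<or>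
          (i' + (e' + 1)) mod q = (i' + (e + 1)) mod q + 1 \<and>
            (i' + (e' + 1)) mod q < e' \<and> e \<le> (i' + (e + 1)) mod q"
          using e(3) by (auto simp: Some B_simps Let_def split: if_splits)
        then show "e = e'"
          using col_e[of i' e e'] col_e_Suc[of i' e e'] col_e_Suc[of i' e' e] e(1,2) by auto
      qed
    qed
    show "inj_on (\<lambda>i. B i e) points" for e
      by (auto simp: line_iff inj_on_def B_simps Let_def split: if_splits)
    show "inj_on (C e) points" for e
      by (auto simp: line_iff inj_on_def C_simps Let_def split: if_splits)
    show "inj_on (\<lambda>e. C e j) {0..<k}" for j
    proof (cases j)
      case None
      then show ?thesis
        by (auto simp: inj_on_def C_simps)
    next
      case (Some j')
      show ?thesis
      proof (rule inj_onI)
        fix e e' assume e: "e \<in> {0..<k}" "e' \<in> {0..<k}" "C e j = C e' j"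
        have "(j' - (e + 1)) mod q = (j' - (e' + 1)) mod q \<or>
          (j' - (e + 1)) mod q = (j' - (e' + 1)) mod q + 1 \<and>
            (j' - (e + 1)) mod q + e \<le> k - 2 \<and> \<not> (j' - (e' + 1)) mod q + e' \<le> k - 2 \<or>
          (j' - (e' + 1)) mod q = (j' - (e + 1)) mod q + 1 \<and>
            (j' - (e' + 1)) mod q + e' \<le> k - 2 \<and> \<not> (j' - (e + 1)) mod q + e \<le> k - 2"
          using e(3) by (auto simp: Some C_simps Let_def split: if_splits)
        then show "e = e'"
          using row_e[of j' e e'] row_e_Suc[of j' e e'] row_e_Suc[of j' e' e] e(1,2) by auto
      qed
    qed
    have gap: "(x + (e + 1)) mod q \<noteq> (x - 1) mod q" if e: "e \<in> {0..<k}" for x e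
      using shift_unique[of x "e + 1" "- 1"] e k by auto
    have gap': "(x - (e + 1)) mod q \<noteq> (x + 1) mod q" if e: "e \<in> {0..<k}" for x e
      using shift_unique'[of x "e + 1" "- 1"] e k by auto
    show "A i j \<noteq> B i e" if e: "e \<in> {0..<k}" for i j e
    proof (cases "i = None \<or> j = None")
      case True
      with gap[OF e] show ?thesis
        by (cases i; cases j) (auto simp: A_simps B_simps Let_def dest: sym)
    next
      case False
      then obtain a b where ij: "i = Some a" "j = Some b"
        by auto
      define s where "s = (a + (e + 1)) mod q"
      have s: "0 \<le> s" "s < q"
        using residue by (auto simp: s_def)
      show ?thesis
      proof
        assume eq: "A i j = B i e"
        show False
        proof (cases "k - 1 \<le> s")
          case True
          then have "mid a b = s" and not: "\<not> (1 \<le> dif a b \<and> dif a b \<le> k)"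
            using eq by (auto simp: ij A_simps B_simps Let_def s_def[symmetric] split: if_splits)
          then have "dif a b = (e + 1) mod q"
            by (subst dif_row) (simp add: s_def mod_simps)
          also have "\<dots> = e + 1"
            using e k by simp
          finally show False
            using not e by simp
        next
          case False
          define f where "f = (if e \<le> s then k - 2 - s else k - 1 - s)"
          have "dif a b = f + 1" and big: "k - 1 \<le> mid a b"
            using eq False
            by (auto simp: ij A_simps B_simps Let_def s_def[symmetric] f_def split: if_splits)
          then have "mid a b = (a + (f + 1)) mod q"
            by (simp add: mid_row[of a b])
          also have "\<dots> = (f + s - e) mod q"
            unfolding mod_eq_dvd_iff using mod_eq_dvd_iff[of "a + (e + 1)" q s]
            by (simp add: s_def algebra_simps)
          also have "\<dots> = f + s - e"
            using e k s False by (auto simp: f_def)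
          finally show False
            using e s False big by (auto simp: f_def split: if_splits)
        qed
      qed
    qed
    show "A i j \<noteq> C e j" if e: "e \<in> {0..<k}" for i j e
    proof (cases "i = None \<or> j = None")
      case True
      with gap'[OF e] show ?thesis
        by (cases i; cases j) (auto simp: A_simps C_simps Let_def dest: sym)
    next
      case False
      then obtain a b where ij: "i = Some a" "j = Some b"
        by auto
      define s where "s = (b - (e + 1)) mod q"
      have s: "0 \<le> s" "s < q"
        using residue by (auto simp: s_def)
      show ?thesis
      proof
        assume eq: "A i j = C e j"
        show False
        proof (cases "k - 1 \<le> s")
          case True
          then have "mid a b = s" and not: "\<not> (1 \<le> dif a b \<and> dif a b \<le> k)"
            using eq by (auto simp: ij A_simps C_simps Let_def s_def[symmetric] split: if_splits)
          then have "dif a b = (e + 1) mod q"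
            by (subst dif_col) (simp add: s_def mod_simps)
          also have "\<dots> = e + 1"
            using e k by simp
          finally show False
            using not e by simp
        next
          case False
          define f where "f = (if s + e \<le> k - 2 then s else s + 1)"
          have "dif a b = f + 1" and big: "k - 1 \<le> mid a b"
            using eq False
            by (auto simp: ij A_simps C_simps Let_def s_def[symmetric] f_def split: if_splits)
          then have "mid a b = (b - (f + 1)) mod q"
            by (simp add: mid_col[of a b])
          also have "\<dots> = (s + e - f) mod q"
            unfolding mod_eq_dvd_iff using mod_eq_dvd_iff[of "b - (e + 1)" q s]
            by (simp add: s_def algebra_simps)
          also have "\<dots> = s + e - f"
            using e k s False by (auto simp: f_def)
          finally show False
            using e s False big by (auto simp: f_def split: if_splits)
        qed
      qed
    qed
  qed (use k card_points in auto)
qed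

definition prolonged :: "int option \<Rightarrow> int option \<Rightarrow> int option" where
  "prolonged i j = (case (i, j) of
       (None, None) \<Rightarrow> None
     | (None, Some j) \<Rightarrow> Some ((j + 1) mod q)
     | (Some i, None) \<Rightarrow> Some ((i - 1) mod q)
     | (Some i, Some j) \<Rightarrow> if dif i j = q - 1 then None else Some (mid i j))"

lemma prolonged_simps [simp]:
  "prolonged None None = None" "prolonged None (Some j) = Some ((j + 1) mod q)"
  "prolonged (Some i) None = Some ((i - 1) mod q)"
  "prolonged (Some i) (Some j) = (if dif i j = q - 1 then None else Some (mid i j))"
  by (simp_all add: prolonged_def)

lemma prolonged_in: "prolonged i j \<in> points"
  using q bounds by (cases i; cases j) auto

lemma prolonged_idem: "q > 1 \<Longrightarrow> i \<in> points \<Longrightarrow> prolonged i i = i"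
  using mid_same dif_same by auto

lemma inj_prolonged_row: "inj_on (prolonged i) points"
proof (cases i)
  case None
  then show ?thesis
    by (auto simp: line_iff inj_on_def)
next
  case (Some i')
  then show ?thesis
    using mid_pred_iff[of i']
        by (auto simp: col_iff inj_on_def eq_commute[of "(i' - 1) mod q"]
            intro: col_unique[of i'] split: if_splits)
qed

lemma inj_prolonged_col: "inj_on (\<lambda>i. prolonged i j) points"
proof (cases j)
  case None
  then show ?thesis
    by (auto simp: line_iff inj_on_def)
next
  case (Some j')
  then show ?thesis
    using mid_succ_iff[of _ j']
        by (auto simp: row_iff inj_on_def eq_commute[of "(j' + 1) mod q"]
            intro: row_unique[of _ j'] split: if_splits)
qed

lemma latin_square_prolonged:
  "latin_square_on (nat q + 1) points points points prolonged"
  by (rule latin_square_onI)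
    (use card_points prolonged_in inj_prolonged_row inj_prolonged_col in simp_all)

lemma diagonal_square_even_half:
  assumes "q > 1"
  shows "\<exists>L. diagonal_square (nat q + 1) (nat q + 1) L"
proof -
  have "\<exists>L. diagonal_square (nat q + 1) (nat q + 1 - card ({} :: int option set)) L"
    by (rule diagonal_square_of_idempotent[OF latin_square_prolonged prolonged_idem,
          where c = id and g = "\<lambda>i j. i"]) (use assms in simp_all)
  then show ?thesis
    by simp
qed

lemma diagonal_square_even_minus_1:
  assumes "q > 1"
  shows "\<exists>L. diagonal_square (nat q + 1) (nat q) L"
proof -
  have "\<exists>L. diagonal_square (nat q + 1) (nat q + 1 - 1) L"
    using assms by (intro diagonal_square_of_idempotent_1[OF latin_square_prolonged prolonged_idem,
          where w = None]) auto
  then show ?thesis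
    by simp
qed

lemma dif_eq_iff: "dif i j = q - 1 \<longleftrightarrow> q dvd j - i + 2"
proof -
  have "dif i j = q - 1 \<longleftrightarrow> q dvd dif i j - (q - 1)"
    using residue_unique[of q "dif i j" "q - 1"] bounds[of "j - i"] by auto
  also have "\<dots> \<longleftrightarrow> q dvd dif i j + 1"
    using dvd_add_left_iff[of q q "dif i j - (q - 1)"] by (simp add: algebra_simps)
  also have "\<dots> \<longleftrightarrow> q dvd 2 * (dif i j + 1)"
    by (rule iffI[OF dvd_mult dvd_double])
  also have "\<dots> \<longleftrightarrow> q dvd (2 * dif i j - (j - i)) + (j - i + 2)"
    by (simp add: algebra_simps)
  also have "\<dots> \<longleftrightarrow> q dvd j - i + 2"
    by (rule dvd_add_right_iff[OF dvd_half[OF q(2)]])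
  finally show ?thesis .
qed

lemma mid_eq_0_iff: "mid i j = 0 \<longleftrightarrow> q dvd i + j"
proof -
  have "mid i j = 0 \<longleftrightarrow> q dvd mid i j"
    using residue_unique[of q "mid i j" 0] bounds[of "i + j"] q by auto
  also have "\<dots> \<longleftrightarrow> q dvd 2 * mid i j"
    by (rule iffI[OF dvd_mult dvd_double])
  also have "\<dots> \<longleftrightarrow> q dvd (2 * mid i j - (i + j)) + (i + j)"
    by simp
  also have "\<dots> \<longleftrightarrow> q dvd i + j"
    by (rule dvd_add_right_iff[OF dvd_half[OF q(2)]])
  finally show ?thesis .
qed

lemma diagonal_square_even_minus_2:
  assumes "q > 1"
  shows "\<exists>L. diagonal_square (nat q + 1) (nat q - 1) L"
proof -
  have q3: "q \<ge> 3"
    using assms q by (cases "q = 2") auto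
  define \<tau> where
    "\<tau> x = (case x of None \<Rightarrow> Some 1 | Some i \<Rightarrow> if i = 1 then None else Some ((2 - i) mod q))" for x
  define pos where
    "pos x = (case x of None \<Rightarrow> False | Some i \<Rightarrow> i \<in> {0, 1} \<or> 2 * i > q + 2)" for x
  have tau_simps: "\<tau> None = Some 1" "\<tau> (Some 1) = None"
    "i \<noteq> 1 \<Longrightarrow> \<tau> (Some i) = Some ((2 - i) mod q)" for i
    by (simp_all add: \<tau>_def)
  have reflect: "(2 - i) mod q = (if i \<le> 2 then 2 - i else q + 2 - i)"
    if "0 \<le> i" "i < q" for i
  proof (cases "i \<le> 2")
    case True
    with that q3 show ?thesis
      by simp
  next
    case False
    have "(2 - i) mod q = (q + 2 - i) mod q"
      unfolding mod_eq_dvd_iff by simp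
    also have "\<dots> = q + 2 - i"
      using that False by simp
    finally show ?thesis
      using False by simp
  qed
  have tau_None: "\<tau> None = Some 1"
    by (simp add: \<tau>_def)
  have tau_Some: "\<tau> (Some i) =
      (if i = 1 then None else if i \<le> 2 then Some (2 - i) else Some (q + 2 - i))"
    if "0 \<le> i" "i < q" for i
    using that by (simp add: \<tau>_def reflect)
  have tau_pos: "\<tau> i \<in> points \<and> \<tau> (\<tau> i) = i \<and> (pos (\<tau> i) \<longleftrightarrow> \<not> pos i)" if "i \<in> points" for i
  proof (cases i)
    case None
    with q3 show ?thesis
      by (simp add: tau_None tau_Some pos_def)
  next
    case (Some a)
    with that have a: "0 \<le> a" "a < q"
      by auto
    have odd: "2 * a \<noteq> q + 2"
      using q(2) by (metis dvd_triv_left even_add even_numeral)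
    consider "a = 1" | "a = 0" | "a = 2" | "a > 2"
      using a by linarith
    then show ?thesis
    proof cases
      case 4
      then have "\<tau> i = Some (q + 2 - a)" "\<tau> (Some (q + 2 - a)) = Some a"
        using a Some by (simp_all add: tau_Some)
      then show ?thesis
        using a odd 4 Some by (auto simp: pos_def)
    qed (use q3 Some in \<open>simp_all add: tau_None tau_Some pos_def\<close>)
  qed
  have mid_reflect: "mid ((2 - a) mod q) b = 0 \<longleftrightarrow> dif a b = q - 1"
    and dif_reflect: "dif ((2 - a) mod q) b = q - 1 \<longleftrightarrow> mid a b = 0" for a b
    unfolding dif_eq_iff mid_eq_0_iff by (simp_all add: dvd_eq_mod_eq_0 mod_simps algebra_simps)
  have both: "a = 1" if "dif a b = q - 1" "mid a b = 0" "0 \<le> a" "a < q" for a b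
  proof -
    have "q dvd 2 * (a - 1)"
      using dvd_diff[of q "a + b" "b - a + 2"] that(1,2)
      unfolding dif_eq_iff mid_eq_0_iff by (simp add: algebra_simps)
    then have "q dvd a - 1"
      by (rule dvd_double)
    then show ?thesis
      by (rule residue_unique) (use that(3,4) q3 in auto)
  qed
  have one: "dif 1 b = q - 1 \<longleftrightarrow> (b + 1) mod q = 0" "mid 1 b = 0 \<longleftrightarrow> (b + 1) mod q = 0" for b
    unfolding dif_eq_iff mid_eq_0_iff by (simp_all add: dvd_eq_mod_eq_0 algebra_simps)
  have pred_0: "a = 1" if "(a - 1) mod q = 0" "0 \<le> a" "a < q" for a
    by (rule residue_unique[of q]) (use that q3 in auto)
  have "\<exists>L. diagonal_square (nat q + 1) (nat q + 1 - 2) L"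
  proof (rule diagonal_square_of_intercalates[OF latin_square_prolonged prolonged_idem,
        where u = "Some 0" and v = None and \<tau> = \<tau> and pos = pos])
    show "\<tau> i \<in> points" "\<tau> (\<tau> i) = i" "pos (\<tau> i) \<longleftrightarrow> \<not> pos i" if "i \<in> points" for i
      using tau_pos[OF that] by blast+
    show "prolonged (\<tau> i) j = None"
      if ij: "i \<in> points" "j \<in> points" "prolonged i j = Some 0" for i j
    proof (cases i)
      case None
      with ij one show ?thesis
        by (cases j) (auto simp: tau_simps)
    next
      case (Some a)
      show ?thesis
      proof (cases "a = 1")
        case True
        with ij one Some show ?thesis
          by (cases j) (auto simp: tau_simps split: if_splits)
      next
        case False
        with ij Some dif_reflect[where a = a] pred_0[where a = a] show ?thesis
          by (cases j) (auto simp: tau_simps split: if_splits)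
      qed
    qed
    show "prolonged (\<tau> i) j = Some 0"
      if ij: "i \<in> points" "j \<in> points" "prolonged i j = None" for i j
    proof (cases i)
      case None
      with ij show ?thesis
        by (cases j) (auto simp: tau_simps)
    next
      case (Some a)
      show ?thesis
      proof (cases "a = 1")
        case True
        with ij one Some show ?thesis
          by (cases j) (auto simp: tau_simps split: if_splits)
      next
        case False
        with ij Some mid_reflect[where a = a] dif_reflect[where a = a] both[where a = a]
        show ?thesis
          by (cases j) (auto simp: tau_simps split: if_splits)
      qed
    qed
  qed (use q3 in \<open>auto simp: pos_def\<close>)
  moreover have "nat q + 1 - 2 = nat q - 1"
    by linarith
  ultimately show ?thesis
    by simp
qed

end

theorem theorem3p9:
  fixes n k :: nat
  assumes "n \<ge> 5" and "k \<ge> 1" and "n \<ge> 2 * k"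
  shows "\<exists>L :: nat \<Rightarrow> nat \<Rightarrow> nat.
           latin_square n L \<and>
           (\<forall>i<n - k. L i i = i) \<and>
           latin_square_on k {n - k..<n} {n - k..<n} {..<k} L \<and>
           (\<exists>T. maximal_partial_transversal n L T \<and> card T = n - k)"
proof -
  define m where "m = n - k"
  have m: "n = m + k" "k \<le> m" "m \<ge> 3"
    using assms by (auto simp: m_def)
  have "\<exists>L. diagonal_square m k L"
  proof (cases "odd m")
    case True
    interpret odd_modulus "int m"
      using True by unfold_locales (auto intro: odd_pos)
    show ?thesis
      using diagonal_square_odd[of "int k"] m by simp
  next
    case False
    define q where "q = int m - 1"
    interpret odd_modulus q
      using False m by unfold_locales (auto simp: q_def)
    have q: "nat q + 1 = m" "q > 1"
      using m by (auto simp: q_def)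
    consider "k + 3 \<le> m" | "k = nat q - 1" | "k = nat q" | "k = nat q + 1"
      using m q by linarith
    then show ?thesis
    proof cases
      case 1
      then show ?thesis
        using diagonal_square_even[of "int k"] q(1) assms(2) by (simp add: q_def)
    qed (use diagonal_square_even_minus_2 diagonal_square_even_minus_1 diagonal_square_even_half q
        in auto)
  qed
  then obtain L where L: "diagonal_square m k L" ..
  have "card ((\<lambda>i. (i, i, i)) ` {..<m}) = m"
    by (subst card_image) (auto simp: inj_on_def)
  with L maximal_diagonal[OF L m(2)] show ?thesis
    unfolding diagonal_square_def m(1) add_diff_cancel_right' by blast
qed

end
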